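(* Let $p>0$ be real and $\mathfrak{S}=\{x\in\mathbb{C}: -1\le \operatorname{Im}(x)\le 0\}$. Let $F_o$ be an odd and $F_e$ an even complex function, both analytic on an open set (symmetric about $0$) containing $\{x\in\mathbb{C}:|\operatorname{Im}(x)|\le1\}$. Put $N(x)=F_o(x)F_e(i+x)-F_e(x)F_o(i+x)$ and suppose that, uniformly for $x\in\mathfrak{S}$ as $\operatorname{Re}(x)\to\pm\infty$, $N(x)=o\!\left(e^{\pi|x|}/|x|\right)$ and $\dfrac{N(x)}{\sinh(\pi p(2x+i))}\to0$. Assume that the integrand below has no pole on the real axis (automatic if $p$ is not an integer). Then $$\int_{-\infty}^{\infty}\frac{F_o(x)F_e(i+x)-F_e(x)F_o(i+x)}{\sinh(\pi p(2x+i))}\,dx$$ $$=\frac{i}{2p}\sum_{n=\lfloor -p\rfloor}^{-1+\lfloor p\rfloor}(-1)^n\left(F_o\!\left(\frac{i(n+1-p)}{2p}\right)F_e\!\left(\frac{i(n+1+p)}{2p}\right)-F_o\!\left(\frac{i(n+1+p)}{2p}\right)F_e\!\left(\frac{i(n+1-p)}{2p}\right)\right).$$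
   Context: The integral over the real line is understood as $\lim_{R\to\infty}\int_{-R}^{R}$ (removable singularities of the integrand being filled in); $\lfloor y\rfloor$ is the greatest integer not exceeding $y$. *)

theory Defs
  imports
    "HOL-Complex_Analysis.Complex_Analysis"
    "HOL-Library.Landau_Symbols"
begin

definition strip :: "complex set" where
  "strip = {x. -1 \<le> Im x \<and> Im x \<le> 0}"

text \<open>
  The filter for ``uniformly for \<open>x\<close> in the strip, as the real part tends to plus or minus
  infinity'': a property holds eventually iff there is a single bound \<open>R\<close>, not depending on
  the imaginary part, such that it holds at all points of the strip with \<open>\<bar>Re x\<bar> \<ge> R\<close>.
\<close>

definition strip_ends :: "complex filter" where
  "strip_ends = inf (filtercomap (\<lambda>x. \<bar>Re x\<bar>) at_top) (principal strip)"

lemma eventually_strip_ends: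
  "eventually P strip_ends \<longleftrightarrow> (\<exists>R. \<forall>x\<in>strip. \<bar>Re x\<bar> \<ge> R \<longrightarrow> P x)"
  unfolding strip_ends_def eventually_inf_principal eventually_filtercomap_at_top_linorder
  by blast

definition numer :: "(complex \<Rightarrow> complex) \<Rightarrow> (complex \<Rightarrow> complex) \<Rightarrow> complex \<Rightarrow> complex" where
  "numer F\<^sub>o F\<^sub>e x = F\<^sub>o x * F\<^sub>e (\<i> + x) - F\<^sub>e x * F\<^sub>o (\<i> + x)"

definition integrand ::
  "real \<Rightarrow> (complex \<Rightarrow> complex) \<Rightarrow> (complex \<Rightarrow> complex) \<Rightarrow> complex \<Rightarrow> complex" where
  "integrand p F\<^sub>o F\<^sub>e x = numer F\<^sub>o F\<^sub>e x / sinh (of_real (pi * p) * (2 * x + \<i>))"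

text \<open>
  The symmetric improper integral over the real line.  Integrability on the truncated intervals
  is demanded explicitly, since \<^const>\<open>integral\<close> is \<open>0\<close> on non-integrable functions.
\<close>

definition has_symmetric_integral :: "(real \<Rightarrow> complex) \<Rightarrow> complex \<Rightarrow> bool" where
  "has_symmetric_integral f I \<longleftrightarrow>
     (\<forall>R>0. f integrable_on {-R..R}) \<and> ((\<lambda>R. integral {-R..R} f) \<longlongrightarrow> I) at_top"

end

theory Submission
  imports Defs
begin

text \<open>
  The map \<open>x \<mapsto> - \<i> - x\<close> is the half turn of the strip \<open>-1 \<le> Im x \<le> 0\<close> about its centre
  \<open>- \<i> / 2\<close>; it exchanges the two boundary lines.  The parities of the two functions
  make the numerator \<open>N\<close> invariant under it (\<open>numer_reflection\<close>), while the kernel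
  \<open>sinh (\<pi> p (2 x + \<i>))\<close> changes sign (\<open>kernel_reflection\<close>), so the integrand \<open>f\<close> satisfies
  \<open>f (- \<i> - x) = - f x\<close>.  As \<open>dx\<close> changes sign as well, opposite sides of a rectangle
  \<open>[-R, R] \<times> [-1, 0]\<close> contribute equally to a contour integral of \<open>f\<close>.  The vertical sides have
  length 1 and \<open>f\<close> tends to \<open>0\<close> uniformly on them, so in the limit the contour
  integral is \<open>- 2\<close> times the integral over the real line, and the residue theorem gives
  \<open>- \<pi> \<i>\<close> times the sum of the residues inside the strip (\<open>strip_symmetric_integral\<close>).

  The kernel vanishes exactly at the points \<open>x\<^sub>k = \<i> (k - p) / (2 p)\<close> with \<open>k\<close> an integer, and
  these zeros are simple, with derivative \<open>2 \<pi> p (-1)\<^sup>k\<close>.  Those with \<open>\<bar>k\<bar> < p\<close> lie in the open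
  strip and contribute the residues \<open>N x\<^sub>k / (2 \<pi> p (-1)\<^sup>k)\<close>.  The index \<open>n\<close> of the claimed sum
  is \<open>k - 1\<close>.

  Zeros lie on the boundary of the strip only if \<open>p\<close> is an integer: they are \<open>0\<close> and \<open>- \<i>\<close>,
  belonging to \<open>k = p\<close> and \<open>k = - p\<close>.  Absence of a pole at \<open>0\<close> forces \<open>N 0 = 0\<close>, whence
  \<open>N (- \<i>) = 0\<close> by the reflection.  Both singularities are then removable, and the term \<open>k = p\<close>
  that the claimed sum contains in this case is \<open>0\<close>.
\<close>

section \<open>Zeros and symmetry of the hyperbolic sine kernel\<close>

lemma sinh_eq_0_iff:
  fixes z :: complex
  shows "sinh z = 0 \<longleftrightarrow> (\<exists>k::int. z = \<i> * of_real (pi * of_int k))"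
proof -
  have "sinh z = 0 \<longleftrightarrow> (\<exists>k::int. \<i> * z = of_real (of_int k * pi))"
    by (simp add: sinh_conv_sin sin_eq_0)
  also have "\<dots> \<longleftrightarrow> (\<exists>k::int. z = \<i> * of_real (pi * of_int (-k)))"
    by (intro ex_cong1) (auto simp: complex_eq_iff algebra_simps)
  also have "\<dots> \<longleftrightarrow> (\<exists>k::int. z = \<i> * of_real (pi * of_int k))"
    by (metis minus_minus)
  finally show ?thesis .
qed

lemma cosh_i_pi_int: "cosh (\<i> * of_real (pi * of_int k)) = (-1 :: complex) powi k"
proof -
  have "\<i> * (\<i> * complex_of_real (pi * of_int k)) = - of_real (pi * of_int k)"
    by simp
  then have "cosh (\<i> * complex_of_real (pi * of_int k)) = of_real (cos (pi * of_int k))"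
    by (simp only: cosh_conv_cos cos_minus cos_of_real)
  then show ?thesis
    by (simp add: power_int_minus_left)
qed

definition kernel_zero :: "real \<Rightarrow> int \<Rightarrow> complex" where
  "kernel_zero p k = \<i> * (of_int k - of_real p) / (2 * of_real p)"

lemma Re_kernel_zero [simp]: "Re (kernel_zero p k) = 0"
  and Im_kernel_zero: "Im (kernel_zero p k) = (of_int k - p) / (2 * p)"
proof -
  have "kernel_zero p k = \<i> * of_real ((of_int k - p) / (2 * p))"
    by (simp add: kernel_zero_def)
  then show "Re (kernel_zero p k) = 0" "Im (kernel_zero p k) = (of_int k - p) / (2 * p)"
    by (simp_all only: Re_i_times Im_i_times Re_complex_of_real Im_complex_of_real neg_0_equal_iff_equal)
qed

lemma kernel_zero_argument:
  assumes "p \<noteq> 0"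
  shows "of_real (pi * p) * (2 * kernel_zero p k + \<i>) = \<i> * of_real (pi * of_int k)"
  using assms by (simp add: kernel_zero_def field_simps)

lemma inj_kernel_zero: "p \<noteq> 0 \<Longrightarrow> inj (kernel_zero p)"
  by (auto simp: inj_on_def kernel_zero_def field_simps)

lemma kernel_eq_0_iff:
  assumes "p > 0"
  shows "sinh (of_real (pi * p) * (2 * x + \<i>)) = 0 \<longleftrightarrow> (\<exists>k. x = kernel_zero p k)"
proof -
  have "of_real (pi * p) * (2 * x + \<i>) = \<i> * of_real (pi * of_int k) \<longleftrightarrow> x = kernel_zero p k" for k
  proof -
    have "of_real (pi * p) * (2 * x + \<i>) = \<i> * of_real (pi * of_int k) \<longleftrightarrow>
        of_real (pi * p) * (2 * x + \<i>) = of_real (pi * p) * (2 * kernel_zero p k + \<i>)"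
      using assms by (simp only: kernel_zero_argument)
    also have "\<dots> \<longleftrightarrow> x = kernel_zero p k"
      using assms by (subst mult_cancel_left) simp
    finally show ?thesis .
  qed
  then show ?thesis
    by (simp only: sinh_eq_0_iff)
qed

lemma kernel_deriv_at_zero:
  assumes "p > 0"
  shows "((\<lambda>x. sinh (of_real (pi * p) * (2 * x + \<i>))) has_field_derivative
            2 * of_real (pi * p) * (-1) powi k) (at (kernel_zero p k))"
proof -
  have "((\<lambda>x. sinh (of_real (pi * p) * (2 * x + \<i>))) has_field_derivative
          cosh (of_real (pi * p) * (2 * kernel_zero p k + \<i>)) * (of_real (pi * p) * 2)) (at (kernel_zero p k))"
    by (auto intro!: derivative_eq_intros)
  also have "cosh (of_real (pi * p) * (2 * kernel_zero p k + \<i>)) = (-1) powi k"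
    using assms by (simp only: kernel_zero_argument cosh_i_pi_int)
  finally show ?thesis
    by (simp add: mult_ac)
qed

lemma kernel_reflection:
  "sinh (of_real (pi * p) * (2 * (- \<i> - x) + \<i>)) = - sinh (of_real (pi * p) * (2 * x + \<i>))"
proof -
  have "of_real (pi * p) * (2 * (- \<i> - x) + \<i>) = - (of_real (pi * p) * (2 * x + \<i>))"
    by (simp add: algebra_simps)
  then show ?thesis
    by (simp only: sinh_minus)
qed

section \<open>Quotients at a simple zero of the denominator\<close>

lemma quotient_limit_simple_zero:
  fixes f h :: "complex \<Rightarrow> complex"
  assumes "isCont f z" "(h has_field_derivative d) (at z)" "h z = 0" "d \<noteq> 0"
  shows "((\<lambda>w. f w / h w * (w - z)) \<longlongrightarrow> f z / d) (at z)"
proof -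
  have "((\<lambda>w. f w / ((h w - h z) / (w - z))) \<longlongrightarrow> f z / d) (at z)"
    using assms by (intro tendsto_divide) (auto simp: isCont_def has_field_derivative_iff)
  then show ?thesis
    using assms(3) by simp
qed

lemma quotient_limit_cancelled_zero:
  fixes f h :: "complex \<Rightarrow> complex"
  assumes "f field_differentiable at z" "f z = 0"
    and "(h has_field_derivative d) (at z)" "h z = 0" "d \<noteq> 0"
  shows "\<exists>c. ((\<lambda>w. f w / h w) \<longlongrightarrow> c) (at z)"
proof -
  obtain e where e: "(f has_field_derivative e) (at z)"
    using assms(1) by (auto simp: field_differentiable_def)
  have "((\<lambda>w. ((f w - f z) / (w - z)) / ((h w - h z) / (w - z))) \<longlongrightarrow> e / d) (at z)"
    using assms e by (intro tendsto_divide) (auto simp: has_field_derivative_iff)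
  moreover have "\<forall>\<^sub>F w in at z. ((f w - f z) / (w - z)) / ((h w - h z) / (w - z)) = f w / h w"
    using assms by (auto simp: eventually_at_filter)
  ultimately show ?thesis
    by (intro exI[of _ "e / d"]) (rule Lim_transform_eventually)
qed

section \<open>Odd functions under a half turn\<close>

lemma remove_sings_odd_reflection:
  assumes lim: "(f \<longlongrightarrow> c) (at z)"
    and odd: "\<forall>\<^sub>F w in at z. f (a - w) = - f w"
  shows "remove_sings f (a - z) = - remove_sings f z"
proof -
  have "((\<lambda>w. f (a - w)) \<longlongrightarrow> - c) (at z)"
    using tendsto_minus[OF lim] by (subst tendsto_cong[OF odd])
  moreover have "filterlim (\<lambda>u. a - u) (at z) (at (a - z))"
  proof (rule filterlim_atI)
    show "((\<lambda>u. a - u) \<longlongrightarrow> z) (at (a - z))"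
      by (auto intro!: tendsto_eq_intros)
    show "\<forall>\<^sub>F u in at (a - z). a - u \<noteq> z"
      unfolding eventually_at_filter by (intro always_eventually) (auto simp: algebra_simps)
  qed
  ultimately have "((\<lambda>u. f (a - (a - u))) \<longlongrightarrow> - c) (at (a - z))"
    by (rule filterlim_compose)
  then have "remove_sings f (a - z) = - c"
    by (intro remove_sings_eqI) simp
  then show ?thesis
    using remove_sings_eqI[OF lim] by simp
qed

text \<open>
  The sign of the function and the reversal of direction cancel: the half turn maps a segment
  to one with the opposite direction vector.
\<close>

lemma contour_integral_linepath_odd_reflection:
  assumes "\<And>z. z \<in> closed_segment a b \<Longrightarrow> f (c - z) = - f z"
  shows "contour_integral (linepath (c - a) (c - b)) f = contour_integral (linepath a b) f"
proof -
  have "f (linepath (c - a) (c - b) t) * (c - b - (c - a)) = f (linepath a b t) * (b - a)"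
    if "t \<in> {0..1}" for t
  proof -
    have "linepath (c - a) (c - b) t = c - linepath a b t"
      by (simp add: linepath_def algebra_simps scaleR_conv_of_real)
    then show ?thesis
      using assms[OF linepath_in_path[OF that]] by (simp only:) (simp add: algebra_simps)
  qed
  then show ?thesis
    unfolding contour_integral_integral by (intro integral_cong) simp
qed

section \<open>Integrals over the boundary of the strip\<close>

text \<open>
  On the rectangle with vertices \<open>\<plusminus>R\<close> and \<open>\<plusminus>R - \<i>\<close> the half turn identifies the bottom side
  with the top side and the right side with the left side, so that half the contour integral is
  carried by the top and the left side alone.  The top side is traversed from right to left,
  which is the source of the minus sign in the value.
\<close>

lemma strip_symmetric_integral:
  fixes g :: "complex \<Rightarrow> complex"
  assumes "open V" "strip \<subseteq> V" "finite P"
    and P: "\<And>z. z \<in> P \<Longrightarrow> -1 < Im z \<and> Im z < 0"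
    and holo: "g holomorphic_on V - P"
    and odd: "\<And>z. z \<in> strip - P \<Longrightarrow> g (- \<i> - z) = - g z"
    and decay: "(g \<longlongrightarrow> 0) strip_ends"
  shows "has_symmetric_integral (\<lambda>t. g (of_real t)) (- pi * \<i> * (\<Sum>z\<in>P. residue g z))"
proof -
  define C where "C = - pi * \<i> * (\<Sum>z\<in>P. residue g z)"
  define side where "side R = contour_integral (linepath (of_real (-R)) (of_real (-R) - \<i>)) g" for R :: real
  \<comment> \<open>a connected domain that serves all rectangles at once: the whole strip lies in one component\<close>
  define S where "S = connected_component_set V 0"
  have "convex strip"
  proof -
    have "convex ({x. Im x \<ge> -1} \<inter> {x. Im x \<le> 0})"
      by (intro convex_Int convex_halfspace_Im_ge convex_halfspace_Im_le)
    then show ?thesis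
      by (simp add: strip_def Int_def)
  qed
  then have "strip \<subseteq> S"
    unfolding S_def using \<open>strip \<subseteq> V\<close>
    by (intro connected_component_maximal convex_connected) (auto simp: strip_def)
  have S: "open S" "connected S" "S \<subseteq> V"
    using \<open>open V\<close> by (auto simp: S_def open_connected_component connected_component_subset)
  have cont: "continuous_on T g" if "T \<subseteq> strip" "T \<inter> P = {}" for T
    by (rule continuous_on_subset[OF holomorphic_on_imp_continuous_on[OF holo]])
      (use that \<open>strip \<subseteq> V\<close> in auto)
  have int_real: "(\<lambda>t. g (of_real t)) integrable_on {-R..R}" for R :: real
  proof (rule integrable_continuous_real)
    have "continuous_on (of_real ` {-R..R}) g"
      by (rule cont) (use P in \<open>force simp: strip_def\<close>)+
    then show "continuous_on {-R..R} (\<lambda>t. g (of_real t))"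
      by (rule continuous_on_compose2[where g = g]) (auto intro!: continuous_intros)
  qed
  obtain M where M: "\<And>z. z \<in> P \<Longrightarrow> \<bar>Re z\<bar> < M"
  proof -
    have "bounded P"
      using \<open>finite P\<close> by (rule finite_imp_bounded)
    then obtain B where "\<forall>z\<in>P. norm z \<le> B"
      by (auto simp: bounded_iff)
    then have "\<bar>Re z\<bar> < B + 1" if "z \<in> P" for z
      using abs_Re_le_cmod[of z] that by fastforce
    then show ?thesis
      by (rule that)
  qed
  \<comment> \<open>once the rectangle encloses \<open>P\<close>, the truncated integral differs from \<open>C\<close> by one vertical side\<close>
  have balance: "integral {-R..R} (\<lambda>t. g (of_real t)) = side R + C" if R: "R > max M 0" for R
  proof -
    define a1 a2 a3 a4 where "a1 = complex_of_real (-R) - \<i>" and "a2 = of_real R - \<i>"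
      and "a3 = complex_of_real R" and "a4 = complex_of_real (-R)"
    have intgr: "g contour_integrable_on linepath a b" if "closed_segment a b \<subseteq> strip - P" for a b
      using that by (intro contour_integrable_continuous_linepath cont) auto
    have corners: "Complex (Re a3) (Im a1) = a2" "Complex (Re a1) (Im a3) = a4"
      by (simp_all add: a1_def a2_def a3_def a4_def complex_eq_iff)
    have rect: "rectpath a1 a3 = linepath a1 a2 +++ linepath a2 a3 +++ linepath a3 a4 +++ linepath a4 a1"
      by (simp add: rectpath_def corners)
    have order: "Re a1 \<le> Re a3" "Im a1 \<le> Im a3" "cbox a1 a3 \<subseteq> strip"
      using R by (auto simp: a1_def a3_def in_cbox_complex_iff strip_def)
    have inside: "P \<subseteq> box a1 a3"
    proof
      fix z assume "z \<in> P"
      then show "z \<in> box a1 a3"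
        using M[of z] P[of z] R by (auto simp: a1_def a3_def in_box_complex_iff)
    qed
    have path: "path_image (rectpath a1 a3) \<subseteq> strip - P"
      using path_image_rectpath_cbox_minus_box[OF order(1,2)] inside order(3) by blast
    have seg: "closed_segment a1 a2 \<subseteq> strip - P" "closed_segment a2 a3 \<subseteq> strip - P"
      "closed_segment a3 a4 \<subseteq> strip - P" "closed_segment a4 a1 \<subseteq> strip - P"
      using path by (simp_all add: rect path_image_join)
    have "contour_integral (rectpath a1 a3) g =
        2 * pi * \<i> * (\<Sum>z\<in>P. winding_number (rectpath a1 a3) z * residue g z)"
    proof (rule Residue_theorem[of S])
      show "g holomorphic_on S - P"
        by (rule holomorphic_on_subset[OF holo]) (use S(3) in auto)
      show "path_image (rectpath a1 a3) \<subseteq> S - P"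
        using path \<open>strip \<subseteq> S\<close> by blast
      show "\<forall>z. z \<notin> S \<longrightarrow> winding_number (rectpath a1 a3) z = 0"
        using order \<open>strip \<subseteq> S\<close> by (intro allI impI winding_number_rectpath_outside) auto
    qed (use S \<open>finite P\<close> in auto)
    also have "(\<Sum>z\<in>P. winding_number (rectpath a1 a3) z * residue g z) = (\<Sum>z\<in>P. residue g z)"
      using inside by (intro sum.cong refl) (auto simp: winding_number_rectpath)
    finally have residues: "contour_integral (rectpath a1 a3) g = - 2 * C"
      by (simp add: C_def)
    have refl: "- \<i> - a3 = a1" "- \<i> - a4 = a2" "- \<i> - a1 = a3"
      by (simp_all add: a1_def a2_def a3_def a4_def)
    have "contour_integral (rectpath a1 a3) g =
        contour_integral (linepath a1 a2) g + contour_integral (linepath a2 a3) g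
        + contour_integral (linepath a3 a4) g + contour_integral (linepath a4 a1) g"
      using seg by (simp add: rect intgr add.assoc)
    also have "contour_integral (linepath a1 a2) g = contour_integral (linepath a3 a4) g"
      using contour_integral_linepath_odd_reflection[of a3 a4 g "- \<i>", unfolded refl] odd seg(3) by blast
    also have "contour_integral (linepath a2 a3) g = contour_integral (linepath a4 a1) g"
      using contour_integral_linepath_odd_reflection[of a4 a1 g "- \<i>", unfolded refl] odd seg(4) by blast
    finally have "2 * (contour_integral (linepath a3 a4) g + contour_integral (linepath a4 a1) g) = 2 * (- C)"
      using residues by simp
    then have "contour_integral (linepath a3 a4) g + contour_integral (linepath a4 a1) g = - C"
      by (simp only: mult_cancel_left) simp
    moreover have "contour_integral (linepath a3 a4) g = - integral {-R..R} (\<lambda>t. g (of_real t))"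
    proof -
      have "contour_integral (linepath a3 a4) g = - contour_integral (linepath a4 a3) g"
        using seg by (intro contour_integral_reverse_linepath cont) auto
      also have "contour_integral (linepath a4 a3) g = integral {-R..R} (\<lambda>t. g (of_real t))"
        using R by (simp add: a3_def a4_def contour_integral_linepath_Reals_eq)
      finally show ?thesis .
    qed
    moreover have "contour_integral (linepath a4 a1) g = side R"
      by (simp add: side_def a4_def a1_def)
    ultimately show ?thesis
      by (simp add: algebra_simps add_eq_0_iff)
  qed
  have side_lim: "(side \<longlongrightarrow> 0) at_top"
  proof (rule tendstoI)
    fix e :: real assume "e > 0"
    then have "\<forall>\<^sub>F x in strip_ends. dist (g x) 0 < e / 2"
      by (intro tendstoD[OF decay]) simp
    then obtain R0 where R0: "\<And>x. x \<in> strip \<Longrightarrow> \<bar>Re x\<bar> \<ge> R0 \<Longrightarrow> norm (g x) < e / 2"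
      unfolding eventually_strip_ends by auto
    show "\<forall>\<^sub>F R in at_top. dist (side R) 0 < e"
    proof (rule eventually_mono[OF eventually_gt_at_top[of "max (max M R0) 0"]])
      fix R assume R: "max (max M R0) 0 < R"
      have seg: "x \<in> strip" "Re x = -R" "x \<notin> P"
        if "x \<in> closed_segment (of_real (-R)) (of_real (-R) - \<i>)" for x
        using that M[of x] R by (auto simp: closed_segment_same_Re closed_segment_eq_real_ivl strip_def)
      have "norm (side R) \<le> e / 2 * norm (complex_of_real (-R) - \<i> - of_real (-R))"
        unfolding side_def
      proof (rule contour_integral_bound_linepath)
        show "g contour_integrable_on linepath (of_real (-R)) (of_real (-R) - \<i>)"
          using seg by (intro contour_integrable_continuous_linepath cont) auto
        show "norm (g x) \<le> e / 2"
          if "x \<in> closed_segment (of_real (-R)) (of_real (-R) - \<i>)" for x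
          using R0[of x] seg[OF that] R by auto
      qed (use \<open>e > 0\<close> in auto)
      then show "dist (side R) 0 < e"
        using \<open>e > 0\<close> by simp
    qed
  qed
  have "((\<lambda>R. side R + C) \<longlongrightarrow> 0 + C) at_top"
    by (intro tendsto_intros side_lim)
  moreover have "\<forall>\<^sub>F R in at_top. side R + C = integral {-R..R} (\<lambda>t. g (of_real t))"
    using balance by (intro eventually_mono[OF eventually_gt_at_top[of "max M 0"]]) simp
  ultimately have "((\<lambda>R. integral {-R..R} (\<lambda>t. g (of_real t))) \<longlongrightarrow> C) at_top"
    unfolding add_0 by (rule Lim_transform_eventually)
  then show ?thesis
    using int_real unfolding has_symmetric_integral_def C_def by blast
qed

section \<open>The integral formula\<close>

lemma numer_reflection:
  assumes "F\<^sub>o (- x) = - F\<^sub>o x" "F\<^sub>o (- \<i> - x) = - F\<^sub>o (\<i> + x)"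
    and "F\<^sub>e (- x) = F\<^sub>e x" "F\<^sub>e (- \<i> - x) = F\<^sub>e (\<i> + x)"
  shows "numer F\<^sub>o F\<^sub>e (- \<i> - x) = numer F\<^sub>o F\<^sub>e x"
  using assms by (simp add: numer_def)

theorem mainTheorem17:
  fixes p :: real
    and F\<^sub>o F\<^sub>e :: "complex \<Rightarrow> complex"
    and U :: "complex set"
  assumes "p > 0"
    and "open U"
    and "\<And>x. x \<in> U \<Longrightarrow> - x \<in> U"
    and "{x. \<bar>Im x\<bar> \<le> 1} \<subseteq> U"
    and "F\<^sub>o analytic_on U"
    and "F\<^sub>e analytic_on U"
    and "\<And>x. x \<in> U \<Longrightarrow> F\<^sub>o (- x) = - F\<^sub>o x"
    and "\<And>x. x \<in> U \<Longrightarrow> F\<^sub>e (- x) = F\<^sub>e x"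
    and "numer F\<^sub>o F\<^sub>e \<in> o[strip_ends](\<lambda>x. of_real (exp (pi * norm x) / norm x))"
    and "(integrand p F\<^sub>o F\<^sub>e \<longlongrightarrow> 0) strip_ends"
    and "\<And>t::real. \<not> is_pole (integrand p F\<^sub>o F\<^sub>e) (of_real t)"
  shows "has_symmetric_integral
           (\<lambda>t. remove_sings (integrand p F\<^sub>o F\<^sub>e) (of_real t))
           (\<i> / (2 * of_real p) *
             (\<Sum>n = \<lfloor>- p\<rfloor>..-1 + \<lfloor>p\<rfloor>. (-1) powi n *
               (F\<^sub>o (\<i> * (of_int n + 1 - of_real p) / (2 * of_real p)) *
                F\<^sub>e (\<i> * (of_int n + 1 + of_real p) / (2 * of_real p)) -
                F\<^sub>o (\<i> * (of_int n + 1 + of_real p) / (2 * of_real p)) *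
                F\<^sub>e (\<i> * (of_int n + 1 - of_real p) / (2 * of_real p)))))"
proof -
  define N where "N = numer F\<^sub>o F\<^sub>e"
  define h where "h = (\<lambda>x. sinh (of_real (pi * p) * (2 * x + \<i>)))"
  define f where "f = integrand p F\<^sub>o F\<^sub>e"
  define g where "g = remove_sings f"
  define d :: "int \<Rightarrow> complex" where "d k = 2 * of_real (pi * p) * (-1) powi k" for k
  define K where "K = {k::int. \<bar>of_int k\<bar> < p}"
  \<comment> \<open>the bound on \<open>Im x\<close> admits exactly the zeros of the kernel with \<open>\<bar>k\<bar> \<le> \<lfloor>p\<rfloor>\<close>, that is, those in
    the closed strip, so that \<open>g\<close> has no singularities in \<open>V\<close> outside the strip\<close>
  define V where "V = {x. x \<in> U \<and> \<i> + x \<in> U \<and> \<bar>2 * p * Im x + p\<bar> < of_int (\<lfloor>p\<rfloor> + 1)}"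
  note p = \<open>p > 0\<close>
  have f_eq: "f = (\<lambda>x. N x / h x)"
    by (simp add: fun_eq_iff f_def integrand_def N_def h_def)
  have d_nz: "d k \<noteq> 0" for k
    using p by (simp add: d_def)
  have h_zero: "h (kernel_zero p k) = 0" for k
    using kernel_eq_0_iff[OF p] by (auto simp: h_def)
  have h_deriv: "(h has_field_derivative d k) (at (kernel_zero p k))" for k
    unfolding h_def d_def by (rule kernel_deriv_at_zero[OF p])
  have "finite K"
  proof (rule finite_subset)
    show "K \<subseteq> {- \<lfloor>p\<rfloor>..\<lfloor>p\<rfloor>}"
    proof
      fix k assume "k \<in> K"
      then have "\<bar>of_int k\<bar> < p"
        by (simp add: K_def)
      then show "k \<in> {- \<lfloor>p\<rfloor>..\<lfloor>p\<rfloor>}"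
        by (simp, linarith)
    qed
  qed simp
  have "open V"
  proof -
    have "open {x. \<bar>2 * p * Im x + p\<bar> < of_int (\<lfloor>p\<rfloor> + 1)}"
      by (intro open_Collect_less continuous_intros)
    moreover have "open ((\<lambda>x. \<i> + x) -` U)"
      by (intro open_vimage \<open>open U\<close> continuous_intros)
    moreover have "V = U \<inter> (\<lambda>x. \<i> + x) -` U \<inter> {x. \<bar>2 * p * Im x + p\<bar> < of_int (\<lfloor>p\<rfloor> + 1)}"
      by (auto simp: V_def)
    ultimately show ?thesis
      using \<open>open U\<close> by auto
  qed
  have "strip \<subseteq> V"
  proof
    fix x assume x: "x \<in> strip"
    have "\<bar>2 * Im x + 1\<bar> \<le> 1"
      using x by (auto simp: strip_def)
    then have "p * \<bar>2 * Im x + 1\<bar> \<le> p"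
      using p by (simp add: mult_left_le)
    also have "p * \<bar>2 * Im x + 1\<bar> = \<bar>2 * p * Im x + p\<bar>"
      using p by (simp add: abs_mult_pos' algebra_simps)
    also have "p < of_int (\<lfloor>p\<rfloor> + 1)"
      by linarith
    finally show "x \<in> V"
      using x assms(4) by (auto simp: V_def strip_def)
  qed
  have N_an: "N analytic_on {x}" if "x \<in> V" for x
  proof -
    have U: "F analytic_on {x}" "(\<lambda>x. F (\<i> + x)) analytic_on {x}" if "F analytic_on U" for F
    proof -
      show "F analytic_on {x}"
        using \<open>x \<in> V\<close> by (intro analytic_on_subset[OF that]) (auto simp: V_def)
      have "F \<circ> (\<lambda>x. \<i> + x) analytic_on {x}"
        using \<open>x \<in> V\<close> by (intro analytic_on_compose_gen[OF _ that] analytic_intros) (auto simp: V_def)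
      then show "(\<lambda>x. F (\<i> + x)) analytic_on {x}"
        by (simp add: o_def)
    qed
    show ?thesis
      unfolding N_def numer_def[abs_def]
      by (intro analytic_intros U assms)
  qed
  have h_an: "h analytic_on A" for A
    unfolding h_def by (intro analytic_intros)
  have f_iso: "isolated_singularity_at f x" if "x \<in> V" for x
    unfolding f_eq
    by (intro isolated_singularity_at_divide isolated_singularity_at_analytic
        not_essential_analytic N_an h_an that)
  have f_an: "f analytic_on {x}" if "x \<in> V" "h x \<noteq> 0" for x
    unfolding f_eq using that by (intro analytic_on_divide N_an h_an) auto
  have N_refl: "N (- \<i> - x) = N x" if "x \<in> V" for x
  proof -
    have "x \<in> U" "\<i> + x \<in> U"
      using that by (auto simp: V_def)
    then show ?thesis
      unfolding N_def
      using assms(7)[of x] assms(7)[of "\<i> + x"] assms(8)[of x] assms(8)[of "\<i> + x"]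
      by (intro numer_reflection) simp_all
  qed
  have f_refl: "f (- \<i> - x) = - f x" if "x \<in> V" for x
    using kernel_reflection[of p x] N_refl[OF that] by (simp only: f_eq h_def divide_minus_right)
  have "0 \<in> V"
    using \<open>strip \<subseteq> V\<close> by (auto simp: strip_def)
  \<comment> \<open>these \<open>k\<close> exist only for integral \<open>p\<close>; their zeros \<open>0\<close> and \<open>- \<i>\<close> lie on the contour\<close>
  have N_end: "N (kernel_zero p k) = 0" if "\<bar>of_int k\<bar> = p" for k
  proof -
    have "of_int k = p \<or> of_int k = - p"
      using that by linarith
    then have ends: "kernel_zero p k = 0 \<or> kernel_zero p k = - \<i>"
      using p by (auto simp: complex_eq_iff Im_kernel_zero field_simps)
    have "kernel_zero p \<bar>k\<bar> = 0"
      using that by (simp add: complex_eq_iff Im_kernel_zero)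
    then have h0: "h 0 = 0" "(h has_field_derivative d \<bar>k\<bar>) (at 0)"
      using h_zero[of "\<bar>k\<bar>"] h_deriv[of "\<bar>k\<bar>"] by simp_all
    have "N 0 = 0"
    proof (rule ccontr)
      assume "N 0 \<noteq> 0"
      have "filterlim h (at 0) (at 0)"
      proof (rule filterlim_atI)
        show "(h \<longlongrightarrow> 0) (at 0)"
          using DERIV_isCont[OF h0(2)] h0(1) by (simp add: isCont_def)
        show "\<forall>\<^sub>F x in at 0. h x \<noteq> 0"
        proof -
          have "((\<lambda>x. h x / x) \<longlongrightarrow> d \<bar>k\<bar>) (at 0)"
            using h0 by (simp add: has_field_derivative_iff)
          then have "\<forall>\<^sub>F x in at 0. h x / x \<noteq> 0"
            by (rule tendsto_imp_eventually_ne) (rule d_nz)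
          then show ?thesis
            by eventually_elim auto
        qed
      qed
      then have "is_pole f 0"
        unfolding f_eq using \<open>N 0 \<noteq> 0\<close> analytic_at_imp_isCont[OF N_an[OF \<open>0 \<in> V\<close>]]
        by (intro is_pole_divide)
      then show False
        using assms(11)[of 0] by (simp add: f_def)
    qed
    moreover have "N (- \<i>) = N 0"
      using N_refl[OF \<open>0 \<in> V\<close>] by simp
    ultimately show ?thesis
      using ends by auto
  qed
  have g_an: "g analytic_on {x}" if x: "x \<in> V - kernel_zero p ` K" for x
  proof (cases "h x = 0")
    case False
    then show ?thesis
      unfolding g_def using x by (intro remove_sings_analytic_on f_an) auto
  next
    case True
    then obtain k where k: "x = kernel_zero p k"
      using kernel_eq_0_iff[OF p] by (auto simp: h_def)
    have "2 * p * Im x + p = of_int k"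
      using p by (simp add: k Im_kernel_zero field_simps)
    then have "of_int \<bar>k\<bar> < (of_int (\<lfloor>p\<rfloor> + 1) :: real)"
      using x by (simp add: V_def)
    then have "\<bar>k\<bar> \<le> \<lfloor>p\<rfloor>"
      by linarith
    then have "\<bar>of_int k\<bar> \<le> p"
      by (simp add: le_floor_iff)
    moreover have "\<not> \<bar>of_int k\<bar> < p"
      using x k by (auto simp: K_def)
    ultimately have "N (kernel_zero p k) = 0"
      by (intro N_end) simp
    moreover have "N field_differentiable at (kernel_zero p k)"
      using x k by (intro analytic_on_imp_differentiable_at[OF N_an]) auto
    ultimately have "\<exists>c. (f \<longlongrightarrow> c) (at x)"
      unfolding f_eq k using h_deriv h_zero d_nz by (intro quotient_limit_cancelled_zero)
    then show ?thesis
      unfolding g_def using x f_iso by (auto intro: remove_sings_analytic_at)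
  qed
  have g_res: "residue g (kernel_zero p k) = N (kernel_zero p k) / d k" if "k \<in> K" for k
  proof -
    have "kernel_zero p k \<in> strip"
      using that p by (auto simp: strip_def Im_kernel_zero K_def field_simps)
    then have V: "kernel_zero p k \<in> V"
      using \<open>strip \<subseteq> V\<close> by auto
    obtain r where r: "r > 0" "f analytic_on ball (kernel_zero p k) r - {kernel_zero p k}"
      using f_iso[OF V] by (auto simp: isolated_singularity_at_def)
    have "residue g (kernel_zero p k) = residue f (kernel_zero p k)"
      unfolding g_def by (rule residue_remove_sings[OF f_iso[OF V]])
    also have "\<dots> = N (kernel_zero p k) / d k"
    proof (rule residue_simple')
      show "f holomorphic_on ball (kernel_zero p k) r - {kernel_zero p k}"
        using r by (intro analytic_imp_holomorphic)
      show "((\<lambda>w. f w * (w - kernel_zero p k)) \<longlongrightarrow> N (kernel_zero p k) / d k) (at (kernel_zero p k))"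
        unfolding f_eq
        by (intro quotient_limit_simple_zero analytic_at_imp_isCont N_an V h_deriv h_zero d_nz)
    qed (use r in auto)
    finally show ?thesis .
  qed
  have "has_symmetric_integral (\<lambda>t. g (of_real t)) (- pi * \<i> * (\<Sum>z\<in>kernel_zero p ` K. residue g z))"
  proof (rule strip_symmetric_integral[OF \<open>open V\<close> \<open>strip \<subseteq> V\<close>])
    show "finite (kernel_zero p ` K)"
      using \<open>finite K\<close> by simp
    show "-1 < Im z \<and> Im z < 0" if "z \<in> kernel_zero p ` K" for z
      using that p by (auto simp: Im_kernel_zero K_def field_simps)
    show "g holomorphic_on V - kernel_zero p ` K"
      using g_an analytic_on_analytic_at by (intro analytic_imp_holomorphic) blast
    show "g (- \<i> - z) = - g z" if z: "z \<in> strip - kernel_zero p ` K" for z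
    proof -
      have zV: "z \<in> V - kernel_zero p ` K"
        using z \<open>strip \<subseteq> V\<close> by auto
      then have "(g \<longlongrightarrow> g z) (at z)"
        using analytic_at_imp_isCont[OF g_an] by (auto simp: isCont_def)
      then have "(f \<longlongrightarrow> g z) (at z)"
        using zV f_iso by (simp add: g_def)
      moreover have "\<forall>\<^sub>F w in at z. f (- \<i> - w) = - f w"
        using eventually_at_in_open'[OF \<open>open V\<close>, of z] zV
        by (auto elim!: eventually_mono intro: f_refl)
      ultimately show ?thesis
        unfolding g_def by (rule remove_sings_odd_reflection)
    qed
    show "(g \<longlongrightarrow> 0) strip_ends"
    proof (rule Lim_transform_eventually)
      show "(f \<longlongrightarrow> 0) strip_ends"
        unfolding f_def by (rule assms(10))
      \<comment> \<open>all zeros of the kernel are on the imaginary axis\<close>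
      have "f x = g x" if "x \<in> strip" "\<bar>Re x\<bar> \<ge> 1" for x
      proof -
        have "h x \<noteq> 0"
          using that kernel_eq_0_iff[OF p, of x] by (auto simp: h_def)
        then show ?thesis
          using f_an[of x] that \<open>strip \<subseteq> V\<close> by (auto simp: g_def)
      qed
      then show "\<forall>\<^sub>F x in strip_ends. f x = g x"
        unfolding eventually_strip_ends by blast
    qed
  qed
  also have "- pi * \<i> * (\<Sum>z\<in>kernel_zero p ` K. residue g z) =
      - pi * \<i> * (\<Sum>k\<in>K. N (kernel_zero p k) / d k)"
    using p by (simp add: sum.reindex[OF inj_on_subset[OF inj_kernel_zero]] g_res)
  \<comment> \<open>for integral \<open>p\<close> the right-hand range contains the additional index \<open>k = p\<close>, where \<open>N\<close> vanishes\<close>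
  also have "(\<Sum>k\<in>K. N (kernel_zero p k) / d k) = (\<Sum>k=\<lfloor>-p\<rfloor>+1..\<lfloor>p\<rfloor>. N (kernel_zero p k) / d k)"
  proof (rule sum.mono_neutral_left)
    show "K \<subseteq> {\<lfloor>-p\<rfloor>+1..\<lfloor>p\<rfloor>}"
    proof
      fix k assume "k \<in> K"
      then have "of_int k < p" "- p < of_int k"
        by (auto simp: K_def)
      then show "k \<in> {\<lfloor>-p\<rfloor>+1..\<lfloor>p\<rfloor>}"
        by (simp, linarith)
    qed
    show "\<forall>k\<in>{\<lfloor>-p\<rfloor>+1..\<lfloor>p\<rfloor>} - K. N (kernel_zero p k) / d k = 0"
    proof
      fix k assume k: "k \<in> {\<lfloor>-p\<rfloor>+1..\<lfloor>p\<rfloor>} - K"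
      then have "\<not> \<bar>of_int k\<bar> < p" "of_int k \<le> p" "- p \<le> of_int k"
        by (auto simp: K_def) linarith+
      then show "N (kernel_zero p k) / d k = 0"
        by (simp add: N_end)
    qed
  qed simp
  also have "\<dots> = (\<Sum>n=\<lfloor>-p\<rfloor>..-1+\<lfloor>p\<rfloor>. N (kernel_zero p (n + 1)) / d (n + 1))"
    by (rule sum.reindex_bij_witness[of _ "\<lambda>n. n + 1" "\<lambda>k. k - 1"]) auto
  also have "- pi * \<i> * \<dots> =
      \<i> / (2 * of_real p) * (\<Sum>n=\<lfloor>-p\<rfloor>..-1+\<lfloor>p\<rfloor>. (-1) powi n * N (kernel_zero p (n + 1)))"
    unfolding sum_distrib_left
  proof (rule sum.cong)
    fix n
    have sq: "(-1) powi n * ((-1) powi n) = (1 :: complex)"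
      by simp
    have "d (n + 1) = - 2 * of_real (pi * p) * (-1) powi n"
      by (simp add: d_def power_int_add)
    then have "- pi * \<i> * (N (kernel_zero p (n + 1)) / d (n + 1)) =
        \<i> / (2 * of_real p) * (N (kernel_zero p (n + 1)) / (-1) powi n)"
      using p by (simp add: field_simps)
    also have "N (kernel_zero p (n + 1)) / (-1) powi n = (-1) powi n * N (kernel_zero p (n + 1))"
      using sq by (simp add: field_simps)
    finally show "- pi * \<i> * (N (kernel_zero p (n + 1)) / d (n + 1)) =
        \<i> / (2 * of_real p) * ((-1) powi n * N (kernel_zero p (n + 1)))" .
  qed simp
  finally have result: "has_symmetric_integral (\<lambda>t. g (of_real t))
      (\<i> / (2 * of_real p) * (\<Sum>n=\<lfloor>-p\<rfloor>..-1+\<lfloor>p\<rfloor>. (-1) powi n * N (kernel_zero p (n + 1))))" .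
  have N_zero: "N (kernel_zero p (n + 1)) =
      F\<^sub>o (\<i> * (of_int n + 1 - of_real p) / (2 * of_real p)) *
      F\<^sub>e (\<i> * (of_int n + 1 + of_real p) / (2 * of_real p)) -
      F\<^sub>o (\<i> * (of_int n + 1 + of_real p) / (2 * of_real p)) *
      F\<^sub>e (\<i> * (of_int n + 1 - of_real p) / (2 * of_real p))" for n
  proof -
    have "\<i> + kernel_zero p (n + 1) = \<i> * (of_int n + 1 + of_real p) / (2 * of_real p)"
      using p by (simp add: kernel_zero_def field_simps)
    then show ?thesis
      by (simp add: N_def numer_def kernel_zero_def mult.commute)
  qed
  show ?thesis
    using result unfolding N_zero g_def f_def .
qed

end
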